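(* Let $A\subset\mathbb{P}$ be an infinite set of primes, with elements listed in increasing order $p_{1;A}<p_{2;A}<\cdots$. Let $N\ge1$ and $A_N=\{p_{1;A},\dots,p_{N;A}\}$. Then for every integer $k\ge2$, $$\sum^{'(k)}_{n:\ p\mid n\Rightarrow p\in A_N}\frac1{n_{\{(k-1)\text{-free}\}}\,\phi\big(n_{\{(k-1)\text{-power}\}}\big)}=\sum_{n:\ p\mid n\Rightarrow p\in A_N}\frac1n,$$ where $\phi$ is Euler's totient function.
   Context: $\mathbb{P}$ denotes the set of primes; sums are over positive integers $n$ all of whose prime divisors lie in $A_N$ (including $n=1$). For $k\ge2$, $n$ is $k$-free if $p^k\nmid n$ for every prime $p$, and $\sum^{'(k)}$ denotes the sum restricted to $k$-free integers. For $m\ge2$, every $n\in\mathbb{N}$ can be written uniquely as $n=n_{\{m\text{-free}\}}\,n_{\{m\text{-power}\}}$ where $n_{\{m\text{-free}\}}$ is $m$-free and $n_{\{m\text{-power}\}}$ is an $m$-th power of a positive integer; for $m=1$ one sets $n_{\{1\text{-free}\}}=1$ and $n_{\{1\text{-power}\}}=n$. *)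

theory Defs
  imports "HOL-Analysis.Analysis" "HOL-Number_Theory.Number_Theory"
begin

definition k_free :: "nat \<Rightarrow> nat \<Rightarrow> bool" where
  "k_free k n \<longleftrightarrow> (\<forall>p. prime p \<longrightarrow> \<not> p ^ k dvd n)"

definition free_power_decomp :: "nat \<Rightarrow> nat \<Rightarrow> nat \<Rightarrow> nat \<Rightarrow> bool" where
  "free_power_decomp m n a b \<longleftrightarrow> n = a * b \<and> k_free m a \<and> (\<exists>c>0. b = c ^ m)"

text \<open>The next two definitions are meaningful for \<open>m \<ge> 1\<close> and \<open>n \<ge> 1\<close>; the descriptions
  are then justified by \<open>free_power_decomp_unique\<close> below.\<close>

definition free_part :: "nat \<Rightarrow> nat \<Rightarrow> nat" where
  "free_part m n = (if m = 1 then 1 else (THE a. \<exists>b. free_power_decomp m n a b))"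

definition power_part :: "nat \<Rightarrow> nat \<Rightarrow> nat" where
  "power_part m n = (if m = 1 then n else (THE b. \<exists>a. free_power_decomp m n a b))"

text \<open>The \<open>N\<close> smallest elements of \<open>A\<close>; \<open>enumerate\<close> counts from \<open>0\<close>.\<close>

definition first_elems :: "nat set \<Rightarrow> nat \<Rightarrow> nat set" where
  "first_elems A N = enumerate A ` {..<N}"

definition supported_on :: "nat set \<Rightarrow> nat set" where
  "supported_on P = {n. n > 0 \<and> (\<forall>p. prime p \<and> p dvd n \<longrightarrow> p \<in> P)}"

lemma free_power_decomp_exists:
  assumes "m \<ge> 1" "n > 0"
  shows "\<exists>a b. free_power_decomp m n a b"
  using assms(2)
proof (induction n rule: less_induct)
  case (less n)
  show ?case
  proof (cases "k_free m n")
    case True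
    then show ?thesis
      unfolding free_power_decomp_def by (intro exI[of _ n] exI[of _ 1]) (auto intro: exI[of _ 1])
  next
    case False
    then obtain p where p: "prime p" "p ^ m dvd n"
      by (auto simp: k_free_def)
    then obtain q where q: "n = p ^ m * q" by (elim dvdE)
    have "p ^ m > 1"
      using prime_gt_1_nat[OF p(1)] assms(1) by (intro one_less_power) auto
    with q less.prems have "q < n" "q > 0" by (auto intro!: Nat.gr0I)
    from less.IH[OF this] obtain a c where ac: "q = a * c ^ m" "k_free m a" "c > 0"
      by (auto simp: free_power_decomp_def)
    have "free_power_decomp m n a ((p * c) ^ m)"
      unfolding free_power_decomp_def using ac q prime_gt_0_nat[OF p(1)]
      by (auto simp: power_mult_distrib intro!: exI[of _ "p * c"])
    then show ?thesis by blast
  qed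
qed

lemma free_power_decomp_unique:
  assumes m: "m \<ge> 1" and n: "n > 0"
  shows "\<exists>!(a, b). free_power_decomp m n a b"
proof -
  have uniq: "a = a' \<and> b = b'"
    if ab: "free_power_decomp m n a b" and ab': "free_power_decomp m n a' b'" for a b a' b'
  proof -
    have val: "multiplicity p x = multiplicity p n mod m"
      if xy: "free_power_decomp m n x y" and p: "prime p" for x y p
    proof -
      from xy obtain c where c: "n = x * c ^ m" "k_free m x" "c > 0"
        by (auto simp: free_power_decomp_def)
      have x0: "x \<noteq> 0" using c n by auto
      have "multiplicity p x < m"
        using c(2) p multiplicity_dvd'[of m p x] by (force simp: k_free_def)
      moreover have "multiplicity p n = multiplicity p x + m * multiplicity p c"
        using c x0 p by (simp add: prime_elem_multiplicity_mult_distrib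
            prime_elem_multiplicity_power_distrib)
      ultimately show ?thesis by simp
    qed
    have n1: "n = a * b" and n2: "n = a' * b'"
      using ab ab' unfolding free_power_decomp_def by blast+
    have "a > 0" using n unfolding n1 by simp
    have "a' > 0" using n unfolding n2 by simp
    have "a = a'"
      using \<open>a > 0\<close> \<open>a' > 0\<close> by (rule multiplicity_eq_nat) (simp add: val[OF ab] val[OF ab'])
    moreover have "a * b = a * b'"
      using n1 n2 \<open>a = a'\<close> by metis
    ultimately show ?thesis using \<open>a > 0\<close> by simp
  qed
  from free_power_decomp_exists[OF m n] obtain a b where "free_power_decomp m n a b" by blast
  with uniq show ?thesis by (intro ex1I[of _ "(a, b)"]) auto
qed

end

theory Submission
  imports Defs
begin

text \<open>Both sums factor over the primes of \<open>A\<^sub>N\<close>. On the left, the factor at \<open>p\<close> is the finite sum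
  \<open>1 + p\<^sup>-\<^sup>1 + \<dots> + p\<^sup>-\<^sup>(\<^sup>k\<^sup>-\<^sup>2\<^sup>) + 1 / \<phi>(p\<^sup>k\<^sup>-\<^sup>1)\<close>, and \<open>1 / \<phi>(p\<^sup>k\<^sup>-\<^sup>1)\<close> is exactly the tail
  \<open>\<Sum>\<^sub>j\<^sub>\<ge>\<^sub>k\<^sub>-\<^sub>1 p\<^sup>-\<^sup>j\<close> of the geometric series, so it equals the factor \<open>1 / (1 - 1/p)\<close> on the right.\<close>

section \<open>Euler products over finite sets of primes\<close>

text \<open>The inverse sends \<open>x\<close> to \<open>multiplicity p x\<close> and the cofactor
  not divisible by \<open>p\<close>. This splits off one prime in the induction for Euler
  products.\<close>

lemma supported_on_insert_bij:
  assumes p: "prime p" and P: "\<forall>q\<in>P. prime q" "p \<notin> P"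
  shows "bij_betw (\<lambda>(e, n). p ^ e * n) (UNIV \<times> supported_on P) (supported_on (insert p P))"
proof -
  have ndvd: "\<not> p dvd n" if "n \<in> supported_on P" for n
    using that p P(2) by (auto simp: supported_on_def)
  have mult: "multiplicity p (p ^ e * n) = e" if "n \<in> supported_on P" for e n
    using ndvd[OF that] p by (intro multiplicity_decomposeI[of _ _ _ n]) auto
  have "inj_on (\<lambda>(e, n). p ^ e * n) (UNIV \<times> supported_on P)"
  proof (rule inj_onI, clarify)
    fix e n e' n'
    assume n: "n \<in> supported_on P" "n' \<in> supported_on P" and eq: "p ^ e * n = p ^ e' * n'"
    have "e = e'"
      using mult[OF n(1), of e] mult[OF n(2), of e'] eq by metis
    with eq p show "e = e' \<and> n = n'" by auto
  qed
  moreover have "(\<lambda>(e, n). p ^ e * n) ` (UNIV \<times> supported_on P) = supported_on (insert p P)"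
  proof (intro equalityI subsetI)
    fix x assume "x \<in> (\<lambda>(e, n). p ^ e * n) ` (UNIV \<times> supported_on P)"
    then obtain e n where x: "x = p ^ e * n" "n \<in> supported_on P" by auto
    have "q \<in> insert p P" if "prime q" "q dvd x" for q
    proof -
      from that x have "q dvd p ^ e \<or> q dvd n" by (simp add: prime_dvd_mult_iff)
      then show ?thesis
        using that(1) p x(2) prime_dvd_power[of q p e] primes_dvd_imp_eq[of q p]
        by (auto simp: supported_on_def)
    qed
    with x p show "x \<in> supported_on (insert p P)"
      by (auto simp: supported_on_def prime_gt_0_nat)
  next
    fix x assume x: "x \<in> supported_on (insert p P)"
    then have "x \<noteq> 0" by (simp add: supported_on_def)
    moreover have "\<not> is_unit p" using p not_prime_unit by blast
    ultimately obtain y where y: "x = p ^ multiplicity p x * y" "\<not> p dvd y"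
      by (rule multiplicity_decompose')
    have "y dvd x" by (subst y(1)) simp
    have "y \<in> supported_on P"
      unfolding supported_on_def
    proof (intro CollectI conjI allI impI)
      show "y > 0" using \<open>y dvd x\<close> \<open>x \<noteq> 0\<close> by (auto intro: Nat.gr0I)
      show "q \<in> P" if "prime q \<and> q dvd y" for q
        using that x y(2) dvd_trans[OF _ \<open>y dvd x\<close>, of q] by (auto simp: supported_on_def)
    qed
    with y(1) show "x \<in> (\<lambda>(e, n). p ^ e * n) ` (UNIV \<times> supported_on P)"
      by force
  qed
  ultimately show ?thesis by (simp add: bij_betw_def)
qed

text \<open>Induction on \<open>P\<close>: splitting off the \<open>p\<close>-part turns the sum
  into a double sum, which separates because the two arguments are coprime. Multiplicativity is
  asked for coprime arguments only, so that totients are covered.\<close>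

lemma euler_product_has_sum:
  fixes f :: "nat \<Rightarrow> real"
  assumes "finite P" and "\<forall>p\<in>P. prime p"
    and nonneg: "\<And>n. 0 \<le> f n" and one: "f 1 = 1"
    and mult: "\<And>a b. a > 0 \<Longrightarrow> b > 0 \<Longrightarrow> coprime a b \<Longrightarrow> f (a * b) = f a * f b"
    and "\<And>p. p \<in> P \<Longrightarrow> ((\<lambda>e. f (p ^ e)) has_sum s p) UNIV"
  shows "(f has_sum (\<Prod>p\<in>P. s p)) (supported_on P)"
  using assms(1,2,6)
proof (induction P rule: finite_induct)
  case empty
  have "supported_on {} = {1}"
    unfolding supported_on_def
    by (intro equalityI subsetI) (use prime_factor_nat in \<open>blast\<close>, use not_prime_1 in auto)
  then show ?case
    using has_sum_finite[of "{1}" f] one by simp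
next
  case (insert p P)
  have p: "prime p" and P: "\<forall>q\<in>P. prime q" using insert.prems by auto
  have IH: "(f has_sum (\<Prod>q\<in>P. s q)) (supported_on P)"
    using insert by auto
  have f_mult: "f (p ^ e * n) = f (p ^ e) * f n" if "n \<in> supported_on P" for e n
  proof (rule mult)
    have "\<not> p dvd n" using that p insert.hyps by (auto simp: supported_on_def)
    then show "coprime (p ^ e) n" using p by (simp add: prime_imp_coprime)
    show "p ^ e > 0" "n > 0"
      using that p by (auto simp: supported_on_def prime_gt_0_nat)
  qed
  let ?g = "\<lambda>(e, n). f (p ^ e * n)"
  have inner: "((\<lambda>n. ?g (e, n)) has_sum (f (p ^ e) * (\<Prod>q\<in>P. s q))) (supported_on P)" for e
    using has_sum_cmult_right[OF IH, of "f (p ^ e)"]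
    by (subst has_sum_cong[where g = "\<lambda>n. f (p ^ e) * f n"]) (auto simp: f_mult)
  have outer: "((\<lambda>e. f (p ^ e) * (\<Prod>q\<in>P. s q)) has_sum (s p * (\<Prod>q\<in>P. s q))) UNIV"
    using insert.prems by (intro has_sum_cmult_left) auto
  \<comment> \<open>Since \<open>f\<close> is nonnegative, convergence of the iterated sum yields
    summability over the product set, which \<open>has_sum_SigmaI\<close> requires.\<close>
  have "(?g has_sum (s p * (\<Prod>q\<in>P. s q))) (UNIV \<times> supported_on P)"
    using inner outer
    by (rule has_sum_SigmaI)
      (rule summable_on_SigmaI[OF inner has_sum_imp_summable[OF outer]], simp add: nonneg)
  then have "(f has_sum (s p * (\<Prod>q\<in>P. s q))) (supported_on (insert p P))"
    using has_sum_reindex_bij_betw[OF supported_on_insert_bij[OF p P insert.hyps(2)], of f]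
    by (simp add: case_prod_unfold)
  with insert.hyps show ?case by simp
qed

section \<open>Freeness and the decomposition under coprime products\<close>

lemma k_free_one: "k > 0 \<Longrightarrow> k_free k 1"
  by (auto simp: k_free_def)

lemma k_free_one_iff: "n > 0 \<Longrightarrow> k_free 1 n \<longleftrightarrow> n = 1"
  using prime_factor_nat[of n] by (auto simp: k_free_def)

text \<open>A prime misses one of two coprime factors, so a power of it dividing the product divides
  the other factor.\<close>

lemma k_free_mult_coprime:
  assumes "k > 0" "coprime a b"
  shows "k_free k (a * b) \<longleftrightarrow> k_free k a \<and> k_free k b"
proof -
  have "p ^ k dvd a * b \<longleftrightarrow> p ^ k dvd a \<or> p ^ k dvd b" if p: "prime p" for p
  proof
    assume *: "p ^ k dvd a * b"
    have "\<not> p dvd a \<or> \<not> p dvd b"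
      using assms(2) p by (meson coprime_common_divisor not_prime_unit)
    then show "p ^ k dvd a \<or> p ^ k dvd b"
      using prime_power_dvd_multD[of p k a b] prime_power_dvd_multD[of p k b a] * p assms(1)
      by (auto simp: mult.commute)
  qed auto
  then show ?thesis by (auto simp: k_free_def)
qed

lemma k_free_prime_power:
  assumes "prime p"
  shows "k_free k (p ^ e) \<longleftrightarrow> e < k"
proof -
  have "q ^ k dvd p ^ e \<longleftrightarrow> k = 0 \<or> (q = p \<and> k \<le> e)" if "prime q" for q
  proof (cases "k = 0")
    case False
    show ?thesis
    proof (cases "q = p")
      case True
      then show ?thesis
        using False assms by (simp add: dvd_power_iff_le prime_ge_2_nat)
    next
      case neq: False
      have "\<not> q ^ k dvd p ^ e"
      proof
        assume "q ^ k dvd p ^ e"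
        then have "q dvd p ^ e" using False by (meson dvd_power dvd_trans neq0_conv)
        then show False
          using that assms neq by (meson prime_dvd_power primes_dvd_imp_eq)
      qed
      with neq False show ?thesis by simp
    qed
  qed simp
  with assms show ?thesis by (auto simp: k_free_def not_le)
qed

lemma free_power_decompD:
  assumes "m \<ge> 1" "n > 0" "free_power_decomp m n a b"
  shows "free_part m n = a" "power_part m n = b"
proof -
  have uniq: "a' = a \<and> b' = b" if "free_power_decomp m n a' b'" for a' b'
    using free_power_decomp_unique[OF assms(1,2)] that assms(3) by auto
  \<comment> \<open>For \<open>m = 1\<close> the two parts are set by hand; these values fit the
    decomposition because 1 is the only 1-free positive integer.\<close>
  have 1: "a = 1 \<and> b = n" if "m = 1"
    using assms that k_free_one_iff[of a] by (auto simp: free_power_decomp_def)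
  have "(THE a. \<exists>b. free_power_decomp m n a b) = a" "(THE b. \<exists>a. free_power_decomp m n a b) = b"
    using uniq assms(3) by (blast intro: the_equality)+
  with 1 show "free_part m n = a" "power_part m n = b"
    by (simp_all add: free_part_def power_part_def)
qed

lemma free_power_decomp_mult_coprime:
  assumes "m > 0" "coprime n n'"
    and d: "free_power_decomp m n a b" "free_power_decomp m n' a' b'"
  shows "free_power_decomp m (n * n') (a * a') (b * b')"
proof -
  obtain c c' where c: "c > 0" "b = c ^ m" "c' > 0" "b' = c' ^ m"
    using d by (auto simp: free_power_decomp_def)
  have "coprime a a'"
    using assms(2) d by (auto simp: free_power_decomp_def)
  then have "k_free m (a * a')"
    using d assms(1) by (simp add: k_free_mult_coprime free_power_decomp_def)
  moreover have "b * b' = (c * c') ^ m" "c * c' > 0"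
    using c by (simp_all add: power_mult_distrib)
  moreover have "n * n' = a * a' * (b * b')"
    using d by (simp add: free_power_decomp_def)
  ultimately show ?thesis
    unfolding free_power_decomp_def by blast
qed

section \<open>The summand and its local factors\<close>

text \<open>Here \<open>m\<close> stands for \<open>k - 1\<close>. Extension by zero replaces the
  restriction to \<open>k\<close>-free integers, so that the Euler product applies on all of
  \<open>supported_on P\<close>.\<close>

definition free_weight :: "nat \<Rightarrow> nat \<Rightarrow> real" where
  "free_weight m n =
     (if k_free (Suc m) n then 1 / (real (free_part m n) * real (totient (power_part m n))) else 0)"

lemma free_weight_nonneg: "free_weight m n \<ge> 0"
  by (simp add: free_weight_def)

text \<open>The decompositions of \<open>n\<close> and \<open>n'\<close> multiply to that of
  \<open>n * n'\<close>; the power parts divide coprime numbers, so the totient splits.\<close>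

lemma free_weight_mult_coprime:
  assumes "m \<ge> 1" "n > 0" "n' > 0" "coprime n n'"
  shows "free_weight m (n * n') = free_weight m n * free_weight m n'"
proof -
  obtain a b a' b' where d: "free_power_decomp m n a b" "free_power_decomp m n' a' b'"
    using free_power_decomp_exists assms by meson
  have d2: "free_power_decomp m (n * n') (a * a') (b * b')"
    using free_power_decomp_mult_coprime d assms by simp
  have "coprime b b'"
    using d assms(4) by (auto simp: free_power_decomp_def)
  then have "totient (b * b') = totient b * totient b'"
    by (rule totient_mult_coprime)
  then show ?thesis
    using free_power_decompD[OF assms(1,2) d(1)] free_power_decompD[OF assms(1,3) d(2)]
      free_power_decompD[OF assms(1) _ d2] assms
    by (simp add: free_weight_def k_free_mult_coprime)
qed

text \<open>Below exponent \<open>m\<close> the prime power is its own free part; at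
  \<open>m\<close> it is a pure power part; beyond \<open>m\<close> it is not
  \<open>Suc m\<close>-free.\<close>

lemma free_weight_prime_power:
  assumes "m \<ge> 1" "prime p"
  shows "free_weight m (p ^ e) =
    (if e < m then 1 / real p ^ e else if e = m then 1 / (real p ^ (m - 1) * (real p - 1)) else 0)"
proof -
  have p0: "p > 0" "p ^ e > 0" using assms by (auto simp: prime_gt_0_nat)
  consider "e < m" | "e = m" | "e > m" by linarith
  then show ?thesis
  proof cases
    case 1
    then have "free_power_decomp m (p ^ e) (p ^ e) 1"
      using assms by (auto simp: free_power_decomp_def k_free_prime_power intro: exI[of _ 1])
    from free_power_decompD[OF assms(1) p0(2) this] 1 show ?thesis
      using assms by (simp add: free_weight_def k_free_prime_power)
  next
    case 2
    then have "free_power_decomp m (p ^ e) 1 (p ^ m)"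
      using assms p0 k_free_one[of m] by (auto simp: free_power_decomp_def)
    from free_power_decompD[OF assms(1) p0(2) this] 2 show ?thesis
      using assms p0
      by (simp add: free_weight_def k_free_prime_power totient_prime_power of_nat_diff)
  next
    case 3
    then show ?thesis
      using assms by (simp add: free_weight_def k_free_prime_power)
  qed
qed

lemma free_weight_has_sum_prime_powers:
  assumes "m \<ge> 1" "prime p"
  shows "((\<lambda>e. free_weight m (p ^ e)) has_sum (1 / (1 - 1 / real p))) UNIV"
proof -
  have p: "real p > 1" using prime_gt_1_nat[OF assms(2)] by simp
  have "(\<Sum>e\<in>{..m}. free_weight m (p ^ e)) =
      (\<Sum>e<m. (1 / real p) ^ e) + 1 / (real p ^ (m - 1) * (real p - 1))"
    using assms
    by (simp add: free_weight_prime_power power_one_over lessThan_Suc_atMost[symmetric])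
  also have "(\<Sum>e<m. (1 / real p) ^ e) = (1 - (1 / real p) ^ m) / (1 - 1 / real p)"
    using p by (subst geometric_sum) (auto simp: field_simps)
  \<comment> \<open>The right-hand side is the closed form of the geometric tail from exponent
    \<open>m\<close> on.\<close>
  also have "1 / (real p ^ (m - 1) * (real p - 1)) = (1 / real p) ^ m / (1 - 1 / real p)"
  proof -
    have "real p ^ m = real p ^ (m - 1) * real p"
      using assms(1) by (cases m) auto
    with p show ?thesis by (simp add: field_simps)
  qed
  also have "(1 - (1 / real p) ^ m) / (1 - 1 / real p) + (1 / real p) ^ m / (1 - 1 / real p) =
      1 / (1 - 1 / real p)"
    by (simp add: add_divide_distrib[symmetric])
  finally have "((\<lambda>e. free_weight m (p ^ e)) has_sum (1 / (1 - 1 / real p))) {..m}"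
    by (intro has_sum_finiteI) simp_all
  also have "?this \<longleftrightarrow> ?thesis"
    using assms by (intro has_sum_cong_neutral) (auto simp: free_weight_prime_power)
  finally show ?thesis .
qed

section \<open>Comparison of the two Euler products\<close>

theorem theorem2:
  fixes A :: "nat set" and N k :: nat
  assumes "\<forall>p\<in>A. prime p"
    and "infinite A"
    and "N \<ge> 1"
    and "k \<ge> 2"
  shows "(\<lambda>n. 1 / (real (free_part (k - 1) n) * real (totient (power_part (k - 1) n))))
           summable_on {n \<in> supported_on (first_elems A N). k_free k n}
       \<and> (\<lambda>n. 1 / real n) summable_on supported_on (first_elems A N)
       \<and> (\<Sum>\<^sub>\<infinity>n\<in>{n \<in> supported_on (first_elems A N). k_free k n}.
            1 / (real (free_part (k - 1) n) * real (totient (power_part (k - 1) n))))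
         = (\<Sum>\<^sub>\<infinity>n\<in>supported_on (first_elems A N). 1 / real n)"
proof -
  let ?P = "first_elems A N" and ?m = "k - 1"
  have m: "?m \<ge> 1" and k: "Suc ?m = k" using assms(4) by auto
  have P: "finite ?P" "\<forall>p\<in>?P. prime p"
    using assms(1,2) by (auto simp: first_elems_def enumerate_in_set)
  \<comment> \<open>The common value. Proving \<open>has_sum\<close> for both sides also gives
    convergence, so the equality is not one of default values of infinite sums.\<close>
  let ?S = "\<Prod>p\<in>?P. 1 / (1 - 1 / real p)"
  have "(free_weight ?m has_sum ?S) (supported_on ?P)"
  proof (rule euler_product_has_sum[OF P free_weight_nonneg _ free_weight_mult_coprime[OF m]])
    show "free_weight ?m 1 = 1"
      \<comment> \<open>1 is read as the zeroth power of the prime 2, and \<open>0 < k - 1\<close>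
        selects the first case.\<close>
      using free_weight_prime_power[OF m two_is_prime_nat, of 0] m by simp
    show "((\<lambda>e. free_weight ?m (p ^ e)) has_sum (1 / (1 - 1 / real p))) UNIV" if "p \<in> ?P" for p
      using free_weight_has_sum_prime_powers[OF m] P(2) that by auto
  qed
  also have "?this \<longleftrightarrow>
      ((\<lambda>n. 1 / (real (free_part ?m n) * real (totient (power_part ?m n)))) has_sum ?S)
        {n \<in> supported_on ?P. k_free k n}"
    unfolding free_weight_def k by (rule has_sum_cong_neutral) auto
  finally have left: \<dots> .
  have right: "((\<lambda>n. 1 / real n) has_sum ?S) (supported_on ?P)"
  proof (rule euler_product_has_sum[OF P])
    show "((\<lambda>e. 1 / real (p ^ e)) has_sum (1 / (1 - 1 / real p))) UNIV" if "p \<in> ?P" for p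
    proof -
      have "real p > 1" using P(2) that prime_gt_1_nat[of p] by simp
      then have "(\<lambda>e. (1 / real p) ^ e) sums (1 / (1 - 1 / real p))"
        by (intro geometric_sums) simp
      then show ?thesis
        \<comment> \<open>Nonnegative terms turn the ordered geometric series into an unordered
          sum.\<close>
        by (intro sums_nonneg_imp_has_sum) (simp_all add: power_one_over)
    qed
  qed simp_all
  show ?thesis
    using has_sum_imp_summable[OF left] has_sum_imp_summable[OF right]
      infsumI[OF left] infsumI[OF right]
    by (intro conjI) (assumption, assumption, rule trans[OF _ sym])
qed

end
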